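(* For any positive integers $l,m,n$, $$\mathrm{def}(K_{l,m,n,l+m+n})\leq \min\{l^{2},m^{2},n^{2}\}.$$
   Context: $K_{l,m,n,l+m+n}$ denotes the complete $4$-partite graph with parts of sizes $l,m,n,l+m+n$ (every two vertices in different parts adjacent, no edges within a part). For a proper edge-coloring $\alpha$ of a graph $G$ (with positive integer colors) and a vertex $v$, let $S(v,\alpha)$ be the set of colors on edges incident to $v$, and $\mathrm{def}(v,\alpha)=\max S(v,\alpha)-\min S(v,\alpha)-|S(v,\alpha)|+1$. The deficiency of $G$ is $\mathrm{def}(G)=\min_\alpha \sum_{v\in V(G)}\mathrm{def}(v,\alpha)$ over all proper edge-colorings $\alpha$ of $G$; equivalently, the minimum number of pendant edges whose attachment to $G$ yields a graph admitting an interval coloring (a proper edge-coloring with colors $1,\ldots,t$, all used, in which every vertex's color set is an integer interval). *)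

theory Defs
  imports Main
begin

type_synonym 'a graph = "'a set \<times> 'a set set"

abbreviation verts :: "'a graph \<Rightarrow> 'a set" where
  "verts G \<equiv> fst G"

abbreviation edges :: "'a graph \<Rightarrow> 'a set set" where
  "edges G \<equiv> snd G"

definition finite_simple_graph :: "'a graph \<Rightarrow> bool" where
  "finite_simple_graph G \<longleftrightarrow>
     finite (verts G) \<and> edges G \<subseteq> {{u, v} | u v. u \<in> verts G \<and> v \<in> verts G \<and> u \<noteq> v}"

text \<open>The vertex \<open>(i, j)\<close> is the \<open>j\<close>-th vertex of the \<open>i\<close>-th part (counting from 0).\<close>

definition complete_multipartite :: "nat list \<Rightarrow> (nat \<times> nat) graph" where
  "complete_multipartite ns =
     (let V = {(i, j). i < length ns \<and> j < ns ! i}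
      in (V, {{u, v} | u v. u \<in> V \<and> v \<in> V \<and> fst u \<noteq> fst v}))"

definition proper_edge_coloring :: "'a graph \<Rightarrow> ('a set \<Rightarrow> nat) \<Rightarrow> bool" where
  "proper_edge_coloring G \<alpha> \<longleftrightarrow>
     (\<forall>e \<in> edges G. \<alpha> e > 0) \<and>
     (\<forall>e \<in> edges G. \<forall>f \<in> edges G. e \<noteq> f \<and> e \<inter> f \<noteq> {} \<longrightarrow> \<alpha> e \<noteq> \<alpha> f)"

definition spectrum :: "'a graph \<Rightarrow> ('a set \<Rightarrow> nat) \<Rightarrow> 'a \<Rightarrow> nat set" where
  "spectrum G \<alpha> v = \<alpha> ` {e \<in> edges G. v \<in> e}"

text \<open>An isolated vertex has empty spectrum, for which \<open>Max\<close> and \<open>Min\<close> are unspecified; its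
  deficiency is set to 0.\<close>

definition vertex_deficiency :: "'a graph \<Rightarrow> ('a set \<Rightarrow> nat) \<Rightarrow> 'a \<Rightarrow> int" where
  "vertex_deficiency G \<alpha> v =
     (let S = spectrum G \<alpha> v
      in if S = {} then 0 else int (Max S) - int (Min S) - int (card S) + 1)"

definition coloring_deficiency :: "'a graph \<Rightarrow> ('a set \<Rightarrow> nat) \<Rightarrow> int" where
  "coloring_deficiency G \<alpha> = (\<Sum>v \<in> verts G. vertex_deficiency G \<alpha> v)"

text \<open>The lemma \<open>deficiency_attained\<close> below shows that this minimum exists for every finite
  simple graph, so that the \<open>LEAST\<close> is never a default value there.\<close>

definition deficiency :: "'a graph \<Rightarrow> int" where
  "deficiency G = (LEAST d. \<exists>\<alpha>. proper_edge_coloring G \<alpha> \<and> d = coloring_deficiency G \<alpha>)"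

lemma finite_edges:
  assumes "finite_simple_graph G"
  shows "finite (edges G)"
proof (rule finite_subset)
  show "edges G \<subseteq> Pow (verts G)" and "finite (Pow (verts G))"
    using assms by (auto simp: finite_simple_graph_def)
qed

lemma finite_simple_graph_complete_multipartite:
  "finite_simple_graph (complete_multipartite ns)"
proof -
  have "{(i, j). i < length ns \<and> j < ns ! i} = Sigma {..<length ns} (\<lambda>i. {..<ns ! i})"
    by auto
  then have "finite {(i, j). i < length ns \<and> j < ns ! i}"
    by simp
  then show ?thesis
    unfolding finite_simple_graph_def complete_multipartite_def Let_def by fastforce
qed

lemma vertex_deficiency_nonneg:
  assumes "finite_simple_graph G"
  shows "vertex_deficiency G \<alpha> v \<ge> 0"
proof (cases "spectrum G \<alpha> v = {}")
  case True
  then show ?thesis by (simp add: vertex_deficiency_def)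
next
  case False
  let ?S = "spectrum G \<alpha> v"
  have fin: "finite ?S"
    using finite_edges[OF assms] by (simp add: spectrum_def)
  then have "?S \<subseteq> {Min ?S..Max ?S}"
    by auto
  then have "card ?S \<le> Suc (Max ?S) - Min ?S"
    using card_mono[of "{Min ?S..Max ?S}" ?S] by simp
  moreover have "Min ?S \<le> Max ?S"
    using fin False by simp
  ultimately show ?thesis
    using False by (simp add: vertex_deficiency_def Let_def)
qed

lemma proper_edge_coloring_exists:
  assumes "finite_simple_graph G"
  shows "\<exists>\<alpha>. proper_edge_coloring G \<alpha>"
proof -
  obtain f :: "'a set \<Rightarrow> nat" where "inj_on f (edges G)"
    using finite_imp_inj_to_nat_seg[OF finite_edges[OF assms]] by blast
  then have "proper_edge_coloring G (\<lambda>e. Suc (f e))"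
    by (auto simp: proper_edge_coloring_def inj_on_def)
  then show ?thesis by blast
qed

lemma deficiency_attained:
  assumes "finite_simple_graph G"
  shows "\<exists>\<alpha>. proper_edge_coloring G \<alpha> \<and> deficiency G = coloring_deficiency G \<alpha> \<and>
    (\<forall>\<beta>. proper_edge_coloring G \<beta> \<longrightarrow> coloring_deficiency G \<alpha> \<le> coloring_deficiency G \<beta>)"
proof -
  have nonneg: "coloring_deficiency G \<alpha> \<ge> 0" for \<alpha>
    unfolding coloring_deficiency_def
    by (intro sum_nonneg vertex_deficiency_nonneg assms)
  obtain \<alpha> where \<alpha>: "proper_edge_coloring G \<alpha>"
    "\<And>\<beta>. proper_edge_coloring G \<beta> \<Longrightarrow>
       nat (coloring_deficiency G \<alpha>) \<le> nat (coloring_deficiency G \<beta>)"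
    using proper_edge_coloring_exists[OF assms]
      ex_has_least_nat[of "proper_edge_coloring G" _ "\<lambda>\<alpha>. nat (coloring_deficiency G \<alpha>)"]
    by blast
  then have min: "coloring_deficiency G \<alpha> \<le> coloring_deficiency G \<beta>"
    if "proper_edge_coloring G \<beta>" for \<beta>
    using that nonneg by (metis nat_le_eq_zle nle_le)
  have "deficiency G = coloring_deficiency G \<alpha>"
    unfolding deficiency_def using \<alpha>(1) min by (intro Least_equality) auto
  then show ?thesis using \<alpha>(1) min by blast
qed

lemma deficiency_le:
  assumes "finite_simple_graph G" and "proper_edge_coloring G \<alpha>"
  shows "deficiency G \<le> coloring_deficiency G \<alpha>"
  using deficiency_attained[OF assms(1)] assms(2) by metis

end

theory Submission
  imports Defs
begin

text \<open>Let the parts \<open>A\<close>, \<open>B\<close>, \<open>C\<close>, \<open>D\<close> have sizes \<open>l\<close>, \<open>m\<close>, \<open>n\<close>, \<open>l + m + n\<close>, and give the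
  edge between the \<open>i\<close>-th vertex of one part and the \<open>j\<close>-th vertex of another the color
  \<open>1 + i + j + c\<close>, where the shift \<open>c\<close> depends on the two parts only, except that the edges between
  \<open>C\<close> and \<open>D\<close> have two shifts, according to whether the vertex of \<open>D\<close> is among the first \<open>l + m\<close>.
  The colors at a vertex then form one translated interval for each part it sees (two for \<open>D\<close> seen
  from \<open>C\<close>), and the shifts are chosen so that these intervals tile a single interval at each vertex
  outside \<open>B\<close>, and an interval with one gap of length \<open>m\<close> at each of the \<open>m\<close> vertices of \<open>B\<close>. Any of
  the three small parts can play the role of \<open>B\<close>.\<close>

text \<open>A doubleton determines its pair up to order, so a symmetric \<open>g\<close> takes one
  value on it. This lets the coloring be written as a function of two endpoints.\<close>

lemma symmetric_function_on_doubletons: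
  assumes "\<And>u v. g u v = g v u"
  shows "\<exists>\<alpha>. \<forall>u v. \<alpha> {u, v} = g u v"
proof (intro exI allI)
  fix u v
  show "(THE c. \<exists>u' v'. {u, v} = {u', v'} \<and> c = g u' v') = g u v"
    using assms by (intro the_equality) (auto simp: doubleton_eq_iff)
qed

text \<open>The deficiency counts the colors missing between the least and the greatest one;
  enlarging that range to \<open>{a..<b}\<close> can only add missing colors.\<close>

lemma vertex_deficiency_le_of_interval:
  assumes "finite_simple_graph G" and "spectrum G \<alpha> v \<subseteq> {a..<b}" and "a \<le> b"
  shows "vertex_deficiency G \<alpha> v \<le> int b - int a - int (card (spectrum G \<alpha> v))"
proof (cases "spectrum G \<alpha> v = {}")
  case True
  then show ?thesis using assms(3) by (simp add: vertex_deficiency_def)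
next
  case False
  have "finite (spectrum G \<alpha> v)"
    using finite_subset[OF assms(2)] by simp
  with False have "Max (spectrum G \<alpha> v) \<in> {a..<b}" "Min (spectrum G \<alpha> v) \<in> {a..<b}"
    using assms(2) Max_in Min_in by blast+
  then show ?thesis using False by (simp add: vertex_deficiency_def Let_def)
qed

lemma verts_complete_multipartite:
  "verts (complete_multipartite ns) = Sigma {..<length ns} (\<lambda>i. {..<ns ! i})"
  by (auto simp: complete_multipartite_def Let_def)

lemma edges_complete_multipartite:
  "edges (complete_multipartite ns) =
     {{u, v} | u v. u \<in> verts (complete_multipartite ns) \<and> v \<in> verts (complete_multipartite ns)
        \<and> fst u \<noteq> fst v}"
  by (simp add: complete_multipartite_def Let_def)

lemma edges_at_complete_multipartite:
  assumes "v \<in> verts (complete_multipartite ns)"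
  shows "{e \<in> edges (complete_multipartite ns). v \<in> e} =
    (\<lambda>u. {v, u}) ` {u \<in> verts (complete_multipartite ns). fst u \<noteq> fst v}"
proof (intro equalityI subsetI)
  let ?V = "verts (complete_multipartite ns)"
  fix e
  assume e: "e \<in> {e \<in> edges (complete_multipartite ns). v \<in> e}"
  then obtain u w where uw: "e = {u, w}" "u \<in> ?V" "w \<in> ?V" "fst u \<noteq> fst w"
    by (auto simp: edges_complete_multipartite)
  then have "v = u \<or> v = w"
    using e by simp
  then show "e \<in> (\<lambda>u. {v, u}) ` {u \<in> ?V. fst u \<noteq> fst v}"
  proof
    assume "v = u"
    then show ?thesis using uw by simp
  next
    assume "v = w"
    then have "e = {v, u}" using uw(1) by (simp only: insert_commute)
    then show ?thesis using uw \<open>v = w\<close> by (intro image_eqI[of _ _ u]) simp_all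
  qed
next
  fix e
  assume "e \<in> (\<lambda>u. {v, u}) ` {u \<in> verts (complete_multipartite ns). fst u \<noteq> fst v}"
  then obtain u where "e = {v, u}" "u \<in> verts (complete_multipartite ns)" "fst v \<noteq> fst u"
    by auto
  then show "e \<in> {e \<in> edges (complete_multipartite ns). v \<in> e}"
    using assms unfolding edges_complete_multipartite mem_Collect_eq
    by (intro conjI exI[of _ v] exI[of _ u]) simp_all
qed

lemma card_neighbours_complete_multipartite:
  assumes "i < length ns"
  shows "card {u \<in> verts (complete_multipartite ns). fst u \<noteq> i} = sum_list ns - ns ! i"
proof -
  have "{u \<in> verts (complete_multipartite ns). fst u \<noteq> i} =
      Sigma ({..<length ns} - {i}) (\<lambda>i. {..<ns ! i})"
    by (auto simp: verts_complete_multipartite)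
  then have "card {u \<in> verts (complete_multipartite ns). fst u \<noteq> i} =
      (\<Sum>i\<in>{..<length ns} - {i}. ns ! i)"
    by simp
  also have "\<dots> = sum_list ns - ns ! i"
    using assms by (simp add: sum_diff1_nat sum_list_sum_nth atLeast0LessThan)
  finally show ?thesis .
qed

text \<open>Counting replaces a proof that the colors fill an interval: injectivity at
  \<open>v\<close> makes the number of colors equal to the degree
  \<open>sum_list ns - ns ! fst v\<close>, so a range longer by \<open>gap v\<close> misses exactly
  \<open>gap v\<close> colors.\<close>

lemma deficiency_complete_multipartite_le:
  fixes ns :: "nat list" and g :: "nat \<times> nat \<Rightarrow> nat \<times> nat \<Rightarrow> nat"
  defines "V \<equiv> verts (complete_multipartite ns)"
  assumes sym: "\<And>u v. g u v = g v u" and pos: "\<And>u v. g u v > 0"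
    and inj: "\<And>v. v \<in> V \<Longrightarrow> inj_on (g v) {u \<in> V. fst u \<noteq> fst v}"
    and interval: "\<And>u v. u \<in> V \<Longrightarrow> v \<in> V \<Longrightarrow> fst u \<noteq> fst v \<Longrightarrow>
      g v u \<in> {lo v..<lo v + (sum_list ns - ns ! fst v) + gap v}"
  shows "deficiency (complete_multipartite ns) \<le> (\<Sum>v\<in>V. int (gap v))"
proof -
  let ?G = "complete_multipartite ns"
  obtain \<alpha> where \<alpha>: "\<And>u v. \<alpha> {u, v} = g u v"
    using symmetric_function_on_doubletons[of g, OF sym] by blast
  have "proper_edge_coloring ?G \<alpha>"
    unfolding proper_edge_coloring_def
  proof (intro conjI ballI impI)
    fix e assume "e \<in> edges ?G"
    then obtain u v where "e = {u, v}" unfolding edges_complete_multipartite by auto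
    then show "\<alpha> e > 0" using pos by (simp add: \<alpha>)
  next
    fix e f assume e: "e \<in> edges ?G" and f: "f \<in> edges ?G" and ef: "e \<noteq> f \<and> e \<inter> f \<noteq> {}"
    then obtain v where v: "v \<in> e" "v \<in> f" by blast
    then have "v \<in> V" using e unfolding edges_complete_multipartite V_def by auto
    then have edges_at: "{e \<in> edges ?G. v \<in> e} = (\<lambda>u. {v, u}) ` {u \<in> V. fst u \<noteq> fst v}"
      unfolding V_def by (rule edges_at_complete_multipartite)
    have "e \<in> (\<lambda>u. {v, u}) ` {u \<in> V. fst u \<noteq> fst v}" "f \<in> (\<lambda>u. {v, u}) ` {u \<in> V. fst u \<noteq> fst v}"
      unfolding edges_at[symmetric] using e f v by simp_all
    then obtain u w where uw: "u \<in> {u \<in> V. fst u \<noteq> fst v}" "w \<in> {u \<in> V. fst u \<noteq> fst v}"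
      and "e = {v, u}" "f = {v, w}"
      by blast
    with ef have "\<alpha> e = g v u" "\<alpha> f = g v w" "u \<noteq> w"
      by (auto simp: \<alpha>)
    then show "\<alpha> e \<noteq> \<alpha> f"
      using inj_onD[OF inj[OF \<open>v \<in> V\<close>] _ uw] by auto
  qed
  then have "deficiency ?G \<le> coloring_deficiency ?G \<alpha>"
    by (intro deficiency_le finite_simple_graph_complete_multipartite)
  also have "\<dots> \<le> (\<Sum>v\<in>V. int (gap v))"
    unfolding coloring_deficiency_def V_def[symmetric]
  proof (rule sum_mono)
    fix v assume v: "v \<in> V"
    have spec: "spectrum ?G \<alpha> v = g v ` {u \<in> V. fst u \<noteq> fst v}"
      using v edges_at_complete_multipartite[of v ns]
      by (simp add: spectrum_def V_def image_image \<alpha>)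
    then have card: "card (spectrum ?G \<alpha> v) = sum_list ns - ns ! fst v"
      using card_image[OF inj[OF v]] card_neighbours_complete_multipartite[of "fst v" ns] v
      by (auto simp: V_def verts_complete_multipartite)
    have "spectrum ?G \<alpha> v \<subseteq> {lo v..<lo v + (sum_list ns - ns ! fst v) + gap v}"
      unfolding spec using interval v by blast
    from vertex_deficiency_le_of_interval[OF finite_simple_graph_complete_multipartite this]
    show "vertex_deficiency ?G \<alpha> v \<le> int (gap v)" by (simp add: card)
  qed
  finally show ?thesis .
qed

text \<open>Testing the unordered sets makes symmetry immediate. For an edge between parts
  \<open>r\<close> and \<open>3\<close>, the last two branches distinguish early and late vertices
  of part \<open>3\<close>.\<close>

definition part_shift ::
    "nat \<Rightarrow> nat \<Rightarrow> nat \<Rightarrow> nat \<Rightarrow> nat \<Rightarrow> nat \<Rightarrow> nat \<times> nat \<Rightarrow> nat \<times> nat \<Rightarrow> nat" where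
  "part_shift p q r l m n u v =
    (let P = {fst u, fst v} in
     if P = {p, q} then 0
     else if P = {p, r} then m
     else if P = {q, r} then l + m
     else if P = {p, 3} then m + n
     else if P = {q, 3} then l + m + n
     else if \<exists>d<l + m. (3, d) \<in> {u, v} then l + 2 * m + n
     else m)"

lemma part_shift_commute: "part_shift p q r l m n u v = part_shift p q r l m n v u"
  by (simp only: part_shift_def insert_commute[of u v] insert_commute[of "fst u" "fst v"])

text \<open>Part \<open>q\<close> plays \<open>B\<close>: each of its \<open>ns ! q\<close> vertices
  contributes a gap of length \<open>ns ! q\<close>, and all other gaps are 0.\<close>

lemma deficiency_le_square:
  assumes len: "length ns = 4" and parts: "{p, q, r} = {0, 1, 2}"
    and last: "ns ! 3 = ns ! p + ns ! q + ns ! r"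
  shows "deficiency (complete_multipartite ns) \<le> (int (ns ! q))\<^sup>2"
proof -
  define l m n where lmn: "l = ns ! p" "m = ns ! q" "n = ns ! r"
  let ?V = "verts (complete_multipartite ns)"
  have dist: "p \<noteq> q" "p \<noteq> r" "q \<noteq> r" "p \<noteq> 3" "q \<noteq> 3" "r \<noteq> 3"
  proof -
    have "card {p, q, r} = 3"
      using parts by simp
    moreover have "{p, q, r} \<subseteq> {0, 1, 2}"
      by (simp only: parts order_refl)
    ultimately show "p \<noteq> q" "p \<noteq> r" "q \<noteq> r" "p \<noteq> 3" "q \<noteq> 3" "r \<noteq> 3"
      by (auto simp: card_insert_if split: if_splits)
  qed
  have "{..<4} = insert 3 {p, q, r}"
    unfolding parts by auto
  then have "{..<4} = {p, q, r, 3}"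
    by auto
  have total: "sum_list ns = l + m + n + (l + m + n)"
    using dist last len \<open>{..<4} = {p, q, r, 3}\<close>
    by (simp add: sum_list_sum_nth atLeast0LessThan lmn)
  have V: "(\<exists>i<l. v = (p, i)) \<or> (\<exists>i<m. v = (q, i)) \<or> (\<exists>i<n. v = (r, i))
      \<or> (\<exists>i<l + m + n. v = (3, i))" if "v \<in> ?V" for v
  proof (cases v)
    case (Pair k i)
    then have "k \<in> {..<4}" "i < ns ! k"
      using that by (simp_all add: verts_complete_multipartite len)
    then have "k = p \<and> i < l \<or> k = q \<and> i < m \<or> k = r \<and> i < n \<or> k = 3 \<and> i < l + m + n"
      unfolding \<open>{..<4} = {p, q, r, 3}\<close> lmn last[symmetric] by blast
    then show ?thesis
      unfolding Pair by blast
  qed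
  note shifts = part_shift_def Let_def doubleton_eq_iff dist dist[symmetric]
  let ?g = "\<lambda>u v. Suc (snd u + snd v + part_shift p q r l m n u v)"
  \<comment> \<open>After subtracting 1 and the index of the vertex, the successive intervals are as
    follows. At \<open>p\<close>: from 0, to \<open>q\<close>, \<open>r\<close>, \<open>3\<close>.
    At \<open>q\<close>: from 0, to \<open>p\<close>, then the gap from \<open>l\<close> to
    \<open>l + m\<close>, then to \<open>r\<close>, \<open>3\<close>. At \<open>r\<close>: from
    \<open>m\<close>, to \<open>p\<close>, \<open>q\<close>, late \<open>3\<close>, early
    \<open>3\<close>; the late indices start at \<open>l + m\<close>, so their shift
    \<open>m\<close> puts them at \<open>l + 2 * m\<close>, right after \<open>q\<close>. At early
    \<open>3\<close>: from \<open>m + n\<close>, to \<open>p\<close>, \<open>q\<close>,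
    \<open>r\<close>. At late \<open>3\<close>: from \<open>m\<close>, to \<open>r\<close>,
    \<open>p\<close>, \<open>q\<close>.\<close>
  let ?lo = "\<lambda>v. Suc (snd v + (if fst v = r \<or> fst v = 3 then m else 0)
    + (if fst v = 3 \<and> snd v < l + m then n else 0))"
  let ?gap = "\<lambda>v. if fst v = q then m else 0"
  have "deficiency (complete_multipartite ns) \<le> (\<Sum>v\<in>?V. int (?gap v))"
  proof (rule deficiency_complete_multipartite_le[where g = ?g and lo = ?lo])
    show "?g u v = ?g v u" for u v
      by (simp add: part_shift_commute add.commute)
    show "inj_on (?g v) {u \<in> ?V. fst u \<noteq> fst v}" if "v \<in> ?V" for v
    proof (rule inj_onI)
      fix u w
      assume u: "u \<in> {u \<in> ?V. fst u \<noteq> fst v}" and w: "w \<in> {u \<in> ?V. fst u \<noteq> fst v}"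
        and eq: "?g v u = ?g v w"
      have "u \<in> ?V" "w \<in> ?V" "fst u \<noteq> fst v" "fst w \<noteq> fst v"
        using u w by simp_all
      then show "u = w"
        \<comment> \<open>Neighbors in one block are separated by their indices; those in different
          blocks by the disjointness of the intervals listed above.\<close>
        using V[OF \<open>u \<in> ?V\<close>] V[OF \<open>w \<in> ?V\<close>] V[OF that] eq
        by (elim disjE exE conjE; simp add: shifts split: if_splits)
    qed
    show "?g v u \<in> {?lo v..<?lo v + (sum_list ns - ns ! fst v) + ?gap v}"
      if "u \<in> ?V" "v \<in> ?V" "fst u \<noteq> fst v" for u v
      using V[OF that(1)] V[OF that(2)] that(3)
      by (elim disjE exE conjE; simp add: shifts total last lmn[symmetric])
  qed simp
  also have "\<dots> = (\<Sum>i<4. \<Sum>j<ns ! i. if i = q then int m else 0)"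
    by (subst sum.Sigma)
      (auto simp: verts_complete_multipartite len case_prod_beta intro!: sum.cong)
  also have "\<dots> = (\<Sum>i<4. if i = q then int m * int m else 0)"
    by (intro sum.cong) (auto simp: lmn)
  also have "\<dots> = (int (ns ! q))\<^sup>2"
    using \<open>{..<4} = {p, q, r, 3}\<close> by (simp add: lmn power2_eq_square)
  finally show ?thesis .
qed

theorem theorem13:
  fixes l m n :: nat
  assumes "l \<ge> 1" and "m \<ge> 1" and "n \<ge> 1"
  shows "deficiency (complete_multipartite [l, m, n, l + m + n])
           \<le> Min {(int l)\<^sup>2, (int m)\<^sup>2, (int n)\<^sup>2}"
proof -
  let ?ns = "[l, m, n, l + m + n]"
  have "deficiency (complete_multipartite ?ns) \<le> (int l)\<^sup>2"
    \<comment> \<open>The middle index selects the part that carries the gaps; here and below each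
      small part takes this role once.\<close>
    using deficiency_le_square[of ?ns 1 0 2] by (simp add: insert_commute)
  moreover have "deficiency (complete_multipartite ?ns) \<le> (int m)\<^sup>2"
    using deficiency_le_square[of ?ns 0 1 2] by simp
  moreover have "deficiency (complete_multipartite ?ns) \<le> (int n)\<^sup>2"
    using deficiency_le_square[of ?ns 0 2 1] by (simp add: insert_commute)
  ultimately show ?thesis by simp
qed

end
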